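(* Let $t$ be an indeterminate, let $M_n(t)=\sum_{k=0}^n\binom{n}{k}^2t^k$, so that $\sum_{n\ge0}M_n(t)x^n=\frac{1}{\sqrt{(1+(1-t)x)^2-4x}}$, and for a positive integer $m$ define $u_m(n,t)$ by $$\left(\frac{1}{\sqrt{(1+(1-t)x)^2-4x}}\right)^m=\sum_{n\ge0}u_m(n,t)x^n$$ (equivalently, $u_m(n,t)=\sum_{i_1+\cdots+i_m=n}M_{i_1}(t)\cdots M_{i_m}(t)$). Then for all $n\ge0$, $$u_m(n,t)=\sum_{k\ge0}\binom{n+m-1}{m-1}\binom{n}{k}\frac{\prod_{j=0}^{k-1}(2n+m-1-2j)}{\prod_{j=0}^{k-1}(2k+m-1-2j)}\,t^k.$$
   Context: Empty products are equal to $1$. *)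

theory Defs
  imports
    "HOL-Computational_Algebra.Computational_Algebra"
    "HOL-Library.Groups_Big_Fun"
begin

text \<open>
  The definitions take \<open>t\<close> in an arbitrary field of characteristic 0; the indeterminate is the
  following element of the field \<open>\<rat>(t)\<close> of rational functions over the rationals. Working in
  the fraction field of \<open>\<rat>[t]\<close> makes division and square roots of power series available.
\<close>

definition indet :: "rat poly fract" where
  "indet = to_fract [:0, 1:]"

definition M :: "nat \<Rightarrow> 'a::field_char_0 \<Rightarrow> 'a" where
  "M n t = (\<Sum>k\<le>n. of_nat (n choose k) ^ 2 * t ^ k)"

text \<open>
  The first argument of \<^const>\<open>fps_radical\<close> supplies the root of the constant coefficient. Here
  that coefficient is 1 and its square root is taken to be 1.
\<close>

definition inv_sqrt_series :: "'a::field_char_0 \<Rightarrow> 'a fps" where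
  "inv_sqrt_series t =
     1 / fps_radical (\<lambda>_ _. 1) 2 ((1 + fps_const (1 - t) * fps_X) ^ 2 - 4 * fps_X)"

definition u :: "nat \<Rightarrow> nat \<Rightarrow> 'a::field_char_0 \<Rightarrow> 'a" where
  "u m n t = fps_nth (inv_sqrt_series t ^ m) n"

end

theory Submission
  imports Defs
begin

text \<open>
  Put \<open>c = (m + 1)/2\<close> and \<open>b k = 1 / (k! (c)\<^sub>k)\<close>. In terms of rising factorials the claimed
  coefficient of \<open>t\<^sup>k\<close> is the symmetric expression \<open>(m)\<^sub>n (c)\<^sub>n b k b (n - k)\<close>. Since
  \<open>b (k - 1) = k (k + c - 1) b k\<close>, the convolution of these terms satisfies a three-term recurrence
  in \<open>n\<close>, which reduces to a polynomial identity for each power of \<open>t\<close>. The same recurrence comes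
  from the differential equation \<open>2 P S' = - m P' S\<close> of \<open>S = P\<^bsup>-m/2\<^esup>\<close>, where
  \<open>P = (1 + (1 - t) x)\<^sup>2 - 4 x\<close>.
\<close>

section \<open>Hypergeometric convolution and its recurrence\<close>

definition bessel_coeff :: "'a::field_char_0 \<Rightarrow> nat \<Rightarrow> 'a" where
  "bessel_coeff c k = 1 / (fact k * pochhammer c k)"

text \<open>The numbers \<open>bessel_coeff c k\<close> are the coefficients of the Bessel-type
  series 0F1(; c; x), so this is the coefficient of x^n in 0F1(; c; t x) 0F1(; c; x).\<close>

definition bessel_conv :: "'a::field_char_0 \<Rightarrow> 'a \<Rightarrow> nat \<Rightarrow> 'a" where
  "bessel_conv c t n = (\<Sum>k\<le>n. bessel_coeff c k * bessel_coeff c (n - k) * t ^ k)"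

lemma bessel_coeff_0 [simp]: "bessel_coeff c 0 = 1"
  by (simp add: bessel_coeff_def)

lemma bessel_coeff_Suc:
  assumes "\<And>k. c + of_nat k \<noteq> 0"
  shows "of_nat (Suc k) * (of_nat (Suc k) + c - 1) * bessel_coeff c (Suc k) = bessel_coeff c k"
proof -
  have s: "(of_nat (Suc k) + c - 1 :: 'a) = c + of_nat k"
    by simp
  show ?thesis
    unfolding s bessel_coeff_def pochhammer_Suc fact_Suc
    using assms[of k] of_nat_neq_0[of k, where ?'a = 'a]
    by (simp del: of_nat_Suc)
qed

text \<open>The weight vanishes at k = 0 and lowers the index of \<open>bessel_coeff\<close>
  elsewhere, so the sum shifts down by one.\<close>

lemma sum_bessel_coeff_left:
  assumes "\<And>k. c + of_nat k \<noteq> 0"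
  shows "(\<Sum>k\<le>Suc n. of_nat k * (of_nat k + c - 1) * bessel_coeff c k * f k)
    = (\<Sum>k\<le>n. bessel_coeff c k * f (Suc k))"
  by (subst sum.atMost_Suc_shift) (simp add: bessel_coeff_Suc[OF assms] del: of_nat_Suc)

text \<open>Here the weight vanishes at the top index k = n + 1, so dropping that term suffices and
  k is not shifted.\<close>

lemma sum_bessel_coeff_right:
  assumes "\<And>k. c + of_nat k \<noteq> 0"
  shows "(\<Sum>k\<le>Suc n. of_nat (Suc n - k) * (of_nat (Suc n - k) + c - 1) * bessel_coeff c (Suc n - k) * f k)
    = (\<Sum>k\<le>n. bessel_coeff c (n - k) * f k)"
  by (simp add: Suc_diff_le bessel_coeff_Suc[OF assms] del: of_nat_Suc of_nat_diff)

lemma bessel_conv_recurrence: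
  fixes c t :: "'a::field_char_0"
  assumes c: "\<And>k. c + of_nat k \<noteq> 0"
  shows "of_nat (n + 2) * (2 * c + of_nat n) * (c + of_nat n + 1) * (c + of_nat n)
      * bessel_conv c t (n + 2)
    = (2 * of_nat n + 1 + 2 * c) * (c + of_nat n) * (1 + t) * bessel_conv c t (n + 1)
      - (1 - t) ^ 2 * bessel_conv c t n"
proof -
  let ?b = "bessel_coeff c" and ?N = "Suc (Suc n)"
  define a where "a = (\<lambda>x::'a. x * (x + c - 1))"
  define w where "w = (\<lambda>k. ?b k * ?b (?N - k) * t ^ k)"
  note L = sum_bessel_coeff_left[OF c] and R = sum_bessel_coeff_right[OF c]
  \<comment> \<open>In the five sums below, each weight on the left index lowers the order of the
    convolution by one and yields a factor t; each weight on the right index only lowers the order.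
    A second weight on the same index is taken at the argument minus 1, which is the index left by
    the first.\<close>
  have A: "(\<Sum>k\<le>?N. a (of_nat k) * w k) = t * bessel_conv c t (Suc n)"
    using L[where n = "Suc n" and f = "\<lambda>k. ?b (?N - k) * t ^ k"]
    by (simp add: a_def w_def bessel_conv_def sum_distrib_left mult_ac
        del: of_nat_diff sum.atMost_Suc)
  have B: "(\<Sum>k\<le>?N. a (of_nat (?N - k)) * w k) = bessel_conv c t (Suc n)"
    using R[where n = "Suc n" and f = "\<lambda>k. ?b k * t ^ k"]
    by (simp add: a_def w_def bessel_conv_def sum_distrib_left mult_ac
        del: of_nat_diff sum.atMost_Suc)
  have AB: "(\<Sum>k\<le>?N. a (of_nat k) * a (of_nat (?N - k)) * w k) = t * bessel_conv c t n"
    using L[where n = "Suc n" and f = "\<lambda>k. a (of_nat (?N - k)) * ?b (?N - k) * t ^ k"]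
      R[where n = n and f = "\<lambda>k. ?b k * t ^ Suc k"]
    by (simp add: a_def w_def bessel_conv_def sum_distrib_left mult_ac
        del: of_nat_diff sum.atMost_Suc)
  have AA: "(\<Sum>k\<le>?N. a (of_nat k) * a (of_nat k - 1) * w k) = t ^ 2 * bessel_conv c t n"
    using L[where n = "Suc n" and f = "\<lambda>k. a (of_nat k - 1) * ?b (?N - k) * t ^ k"]
      L[where n = n and f = "\<lambda>k. ?b (Suc n - k) * t ^ Suc k"]
    by (simp add: a_def w_def bessel_conv_def sum_distrib_left mult_ac power2_eq_square
        del: of_nat_diff sum.atMost_Suc)
  have BB: "(\<Sum>k\<le>?N. a (of_nat (?N - k)) * a (of_nat (?N - k) - 1) * w k) = bessel_conv c t n"
  proof -
    \<comment> \<open>For k <= n + 1, \<open>of_nat (?N - k) - 1\<close> equals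
      \<open>of_nat (Suc n - k)\<close>, so the remaining weight has the form to which
      \<open>R\<close> applies again.\<close>
    have "(\<Sum>k\<le>Suc n. ?b (Suc n - k) * (a (of_nat (?N - k) - 1) * ?b k * t ^ k))
      = (\<Sum>k\<le>Suc n. of_nat (Suc n - k) * (of_nat (Suc n - k) + c - 1) * ?b (Suc n - k) * (?b k * t ^ k))"
      by (rule sum.cong) (simp_all add: a_def Suc_diff_le mult_ac)
    then show ?thesis
      using R[where n = "Suc n" and f = "\<lambda>k. a (of_nat (?N - k) - 1) * ?b k * t ^ k"] R[where n = n and f = "\<lambda>k. ?b k * t ^ k"]
      by (simp add: a_def w_def bessel_conv_def sum_distrib_left mult_ac
        del: of_nat_diff sum.atMost_Suc)
  qed
  have "of_nat (n + 2) * (2 * c + of_nat n) * (c + of_nat n + 1) * (c + of_nat n) * bessel_conv c t (n + 2)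
    = (\<Sum>k\<le>?N. of_nat (n + 2) * (2 * c + of_nat n) * (c + of_nat n + 1) * (c + of_nat n) * w k)"
    by (simp add: bessel_conv_def w_def sum_distrib_left del: sum.atMost_Suc)
  also have "\<dots> = (\<Sum>k\<le>?N. (2 * of_nat n + 1 + 2 * c) * (c + of_nat n) * (a (of_nat k) * w k)
      + (2 * of_nat n + 1 + 2 * c) * (c + of_nat n) * (a (of_nat (?N - k)) * w k)
      - (a (of_nat (?N - k)) * a (of_nat (?N - k) - 1) * w k
      - 2 * (a (of_nat k) * a (of_nat (?N - k)) * w k) + a (of_nat k) * a (of_nat k - 1) * w k))"
  proof (rule sum.cong)
    fix k assume "k \<in> {..?N}"
    then have l: "of_nat (?N - k) = (of_nat n + 2 - of_nat k :: 'a)"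
      by (simp add: of_nat_diff)
    \<comment> \<open>Here x stands for n and x + 2 - k for the complementary index. The identity
      writes a factor free of k as a combination of the five weights.\<close>
    have "(x + 2) * (2 * c + x) * (c + x + 1) * (c + x) * W
      = (2 * x + 1 + 2 * c) * (c + x) * (a k * W)
      + (2 * x + 1 + 2 * c) * (c + x) * (a (x + 2 - k) * W)
      - (a (x + 2 - k) * a (x + 2 - k - 1) * W
      - 2 * (a k * a (x + 2 - k) * W) + a k * a (k - 1) * W)" for x k W :: 'a
      unfolding a_def by algebra
    from this[of "of_nat n" "w k" "of_nat k"]
    show "of_nat (n + 2) * (2 * c + of_nat n) * (c + of_nat n + 1) * (c + of_nat n) * w k =
      (2 * of_nat n + 1 + 2 * c) * (c + of_nat n) * (a (of_nat k) * w k)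
      + (2 * of_nat n + 1 + 2 * c) * (c + of_nat n) * (a (of_nat (?N - k)) * w k)
      - (a (of_nat (?N - k)) * a (of_nat (?N - k) - 1) * w k
      - 2 * (a (of_nat k) * a (of_nat (?N - k)) * w k) + a (of_nat k) * a (of_nat k - 1) * w k)"
      unfolding l by (simp only: of_nat_add of_nat_numeral)
  qed simp
  also have "\<dots> = (2 * of_nat n + 1 + 2 * c) * (c + of_nat n) * (t * bessel_conv c t (Suc n))
     + (2 * of_nat n + 1 + 2 * c) * (c + of_nat n) * bessel_conv c t (Suc n)
     - (bessel_conv c t n - 2 * (t * bessel_conv c t n) + t ^ 2 * bessel_conv c t n)"
    by (simp only: sum.distrib sum_subtractf sum_distrib_left[symmetric] A B AB AA BB)
  also have "\<dots> = (2 * of_nat n + 1 + 2 * c) * (c + of_nat n) * (1 + t) * bessel_conv c t (n + 1)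
      - (1 - t) ^ 2 * bessel_conv c t n"
    by (simp only: Suc_eq_plus1) algebra
  finally show ?thesis .
qed

section \<open>Differential equation and recurrence for powers of the series\<close>

lemma inv_sqrt_series_square:
  "inv_sqrt_series t ^ 2 * ((1 + fps_const (1 - t) * fps_X) ^ 2 - 4 * fps_X) = 1"
  and inv_sqrt_series_nth_0: "fps_nth (inv_sqrt_series t) 0 = 1"
proof -
  define P where "P = (1 + fps_const (1 - t) * fps_X) ^ 2 - 4 * fps_X"
  define R where "R = fps_radical (\<lambda>_ _. 1) 2 P"
  have P0: "fps_nth P 0 = 1"
    by (simp add: P_def power2_eq_square numeral_fps_const)
  \<comment> \<open>The chosen root 1 is a valid square root of the constant coefficient 1, so the
    formal radical really squares to P.\<close>
  have R2: "R ^ 2 = P"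
    using power_radical[of P "\<lambda>_ _. 1" 1] P0 by (simp add: R_def numeral_2_eq_2)
  have R0: "fps_nth R 0 = 1"
    by (simp add: R_def)
  have S: "inv_sqrt_series t = inverse R"
    using R0 by (simp add: inv_sqrt_series_def R_def P_def fps_divide_unit)
  have "inverse R * R = 1"
    using R0 by (intro inverse_mult_eq_1) simp
  then have "inverse R ^ 2 * R ^ 2 = 1"
    by (simp flip: power_mult_distrib)
  with R2 S show "inv_sqrt_series t ^ 2 * ((1 + fps_const (1 - t) * fps_X) ^ 2 - 4 * fps_X) = 1"
    by (simp add: P_def)
  show "fps_nth (inv_sqrt_series t) 0 = 1"
    using R0 S by simp
qed

text \<open>With P the quadratic on the left, P' = -2 ((1 + t) - (1 - t)^2 x), so this is 2 P S' =
  -m P' S after cancelling 2.\<close>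

lemma inv_sqrt_series_power_deriv:
  fixes t :: "'a::field_char_0" and m :: nat
  defines "S \<equiv> inv_sqrt_series t ^ m"
  shows "(1 - fps_const (2 * (1 + t)) * fps_X + fps_const ((1 - t) ^ 2) * fps_X ^ 2) * fps_deriv S
    = of_nat m * (fps_const (1 + t) - fps_const ((1 - t) ^ 2) * fps_X) * S"
proof -
  define T where "T = inv_sqrt_series t"
  define P where "P = (1 - fps_const (2 * (1 + t)) * fps_X + fps_const ((1 - t) ^ 2) * fps_X ^ 2)"
  define Q where "Q = (fps_const (1 + t) - fps_const ((1 - t) ^ 2) * fps_X)"
  have "(1 + fps_const (1 - t) * fps_X) ^ 2 - 4 * fps_X = P"
  proof -
    have "fps_const (2 * (1 + t)) = 4 - 2 * fps_const (1 - t)"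
      by (simp add: numeral_fps_const algebra_simps)
    moreover have "fps_const ((1 - t) ^ 2) = fps_const (1 - t) ^ 2"
      by (simp add: fps_const_power)
    ultimately show ?thesis
      unfolding P_def by (simp add: power2_eq_square algebra_simps)
  qed
  with inv_sqrt_series_square[of t] have TP: "T ^ 2 * P = 1"
    by (simp add: T_def)
  have "fps_deriv P = - 2 * Q"
    by (simp add: P_def Q_def fps_deriv_power numeral_fps_const algebra_simps)
  \<comment> \<open>Differentiating T^2 P = 1 leaves a factor 2 T, which is cancelled because power
    series over a field of characteristic 0 have no zero divisors.\<close>
  with arg_cong[OF TP, of fps_deriv] have "2 * T * (fps_deriv T * P - T * Q) = 0"
    by (simp add: fps_deriv_power power2_eq_square algebra_simps)
  moreover have "T \<noteq> 0"
    using TP by auto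
  ultimately have D: "P * fps_deriv T = Q * T"
    by (simp add: mult_ac)
  show ?thesis
  \<comment> \<open>The power rule involves the exponent m - 1; for m = 0 both sides vanish.\<close>
  proof (cases m)
    case 0
    then show ?thesis by (simp add: S_def)
  next
    case (Suc r)
    have "P * fps_deriv S = of_nat m * T ^ r * (P * fps_deriv T)"
      unfolding S_def T_def[symmetric] fps_deriv_power fps_of_nat by (simp add: Suc mult_ac)
    also have "\<dots> = of_nat m * Q * S"
      unfolding D S_def T_def[symmetric] by (simp add: Suc mult_ac)
    finally show ?thesis
      by (simp add: P_def Q_def)
  qed
qed

lemma u_0 [simp]: "u m 0 t = 1"
  by (simp add: u_def inv_sqrt_series_nth_0 fps_power_zeroth)

lemma u_Suc_0: "u m (Suc 0) t = of_nat m * (1 + t)"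
  using arg_cong[OF inv_sqrt_series_power_deriv[of t m], of "\<lambda>f. fps_nth f 0"]
  by (simp add: u_def inv_sqrt_series_nth_0 fps_power_zeroth flip: fps_of_nat)

text \<open>This compares coefficients of x^(n+1) in the differential equation.\<close>

lemma u_recurrence:
  "of_nat (n + 2) * u m (n + 2) t
    = (2 * of_nat n + 2 + of_nat m) * (1 + t) * u m (n + 1) t
      - (of_nat n + of_nat m) * (1 - t) ^ 2 * u m n t"
proof -
  define S where "S = inv_sqrt_series t ^ m"
  define q where "q = (1 - t) ^ 2"
  have "fps_deriv S - fps_const (2 * (1 + t)) * (fps_X * fps_deriv S)
      + fps_const q * (fps_X ^ 2 * fps_deriv S)
    = fps_const (of_nat m * (1 + t)) * S - fps_const (of_nat m * q) * (fps_X * S)"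
    using inv_sqrt_series_power_deriv[of t m]
    unfolding S_def q_def
    by (simp add: algebra_simps flip: fps_of_nat fps_const_mult)
  from arg_cong[OF this, of "\<lambda>f. fps_nth f (Suc n)"]
  have "of_nat (n + 2) * fps_nth S (n + 2)
      - 2 * (1 + t) * (of_nat (n + 1) * fps_nth S (n + 1)) + q * (of_nat n * fps_nth S n)
    = of_nat m * (1 + t) * fps_nth S (n + 1) - of_nat m * q * fps_nth S n"
    \<comment> \<open>For n = 0 the product x^2 S' has no coefficient at x^1, in agreement with the
      factor n.\<close>
    by (cases n) (simp_all add: fps_X_power_mult_nth del: of_nat_Suc)
  then show ?thesis
    unfolding u_def S_def[symmetric] q_def[symmetric] of_nat_add of_nat_1 by algebra
qed

section \<open>Matching the recurrences and the closed form\<close>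

lemma half_Suc_add_of_nat_neq_0: "(of_nat m + 1) / 2 + of_nat k \<noteq> (0 :: 'a::field_char_0)"
proof -
  have "2 * ((of_nat m + 1) / 2 + of_nat k) = (of_nat (Suc (m + 2 * k)) :: 'a)"
    by (simp add: field_simps)
  then show ?thesis
    using of_nat_neq_0[of "m + 2 * k", where ?'a = 'a] by fastforce
qed

text \<open>Both sides are 1 at n = 0 and m (1 + t) at n = 1, and both satisfy the recurrence of
  \<open>u_recurrence\<close>.\<close>

lemma u_eq_bessel_conv:
  fixes t :: "'a::field_char_0" and m :: nat
  defines "c \<equiv> (of_nat m + 1) / 2"
  shows "u m n t = pochhammer (of_nat m) n * pochhammer c n * bessel_conv c t n"
proof -
  have c: "c + of_nat k \<noteq> 0" for k
    unfolding c_def by (rule half_Suc_add_of_nat_neq_0)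
  have m: "of_nat m = 2 * c - 1"
    by (simp add: c_def field_simps)
  show ?thesis
  proof (induction n rule: induct_nat_012)
    case 0
    show ?case by (simp add: bessel_conv_def)
  next
    case 1
    show ?case using c[of 0]
      by (simp add: u_Suc_0 bessel_conv_def bessel_coeff_def field_simps)
  next
    case (ge2 n)
    define v where "v = bessel_conv c t"
    define p where "p = pochhammer (of_nat m) n * pochhammer c n"
    have p1: "pochhammer (of_nat m) (Suc n) * pochhammer c (Suc n)
      = p * (of_nat m + of_nat n) * (c + of_nat n)"
      by (simp add: p_def pochhammer_Suc)
    have p2: "pochhammer (of_nat m) (Suc (Suc n)) * pochhammer c (Suc (Suc n))
      = p * (of_nat m + of_nat n) * (c + of_nat n) * (of_nat m + of_nat n + 1) * (c + of_nat n + 1)"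
      by (simp add: p_def pochhammer_Suc add_ac mult_ac)
    have V: "(of_nat n + 2) * (2 * c + of_nat n) * (c + of_nat n + 1) * (c + of_nat n) * v (Suc (Suc n))
      = (2 * of_nat n + 1 + 2 * c) * (c + of_nat n) * (1 + t) * v (Suc n) - (1 - t) ^ 2 * v n"
      using bessel_conv_recurrence[OF c, of n t] by (simp add: v_def add.commute[of 2])
    have U: "(of_nat n + 2) * u m (Suc (Suc n)) t
      = (2 * of_nat n + 2 + of_nat m) * (1 + t) * u m (Suc n) t
        - (of_nat n + of_nat m) * (1 - t) ^ 2 * u m n t"
      using u_recurrence[of n m t] by (simp add: add.commute[of 2])
    \<comment> \<open>Since 2 c = m + 1, the factor 2 c + n in \<open>V\<close> is m + n + 1;
      multiplying \<open>V\<close> by p (m + n) gives exactly the rescaled recurrence.\<close>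
    have "(of_nat n + 2) * u m (Suc (Suc n)) t =
      (of_nat n + 2) * (pochhammer (of_nat m) (Suc (Suc n)) * pochhammer c (Suc (Suc n)) * v (Suc (Suc n)))"
      unfolding U ge2.IH p1 p2 p_def[symmetric] v_def[symmetric]
      using V m by algebra
    moreover have "of_nat n + 2 \<noteq> (0 :: 'a)"
      using of_nat_neq_0[of "Suc n", where ?'a = 'a] by (simp add: add_ac)
    ultimately show ?case
      unfolding v_def by simp
  qed
qed

text \<open>With c = (m + 1)/2 each factor is 2 (c + n - 1 - j), so the product consists of the top
  k factors of \<open>pochhammer c n\<close>, each doubled. The case n = k evaluates the denominator
  of the closed form.\<close>

lemma prod_step_two_pochhammer:
  fixes m n k :: nat
  assumes "k \<le> n"
  shows "(\<Prod>j<k. 2 * of_nat n + of_nat m - 1 - 2 * of_nat j)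
      * pochhammer ((of_nat m + 1) / 2) (n - k)
    = (2 ^ k * pochhammer ((of_nat m + 1) / 2) n :: 'a::field_char_0)"
  using assms
proof (induction k)
  case (Suc k)
  define c :: 'a where "c = (of_nat m + 1) / 2"
  have "n - k = Suc (n - Suc k)"
    using Suc.prems by simp
  then have step: "pochhammer c (n - k) = pochhammer c (n - Suc k) * (c + of_nat (n - Suc k))"
    by (simp only: pochhammer_Suc)
  have factor: "2 * of_nat n + of_nat m - 1 - 2 * of_nat k = 2 * (c + of_nat (n - Suc k))"
    using Suc.prems by (simp add: c_def of_nat_diff field_simps)
  have "(\<Prod>j<k. 2 * of_nat n + of_nat m - 1 - 2 * of_nat j) * pochhammer c (n - k)
      = 2 ^ k * pochhammer c n"
    using Suc unfolding c_def by simp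
  from arg_cong[OF this, of "(*) 2"] show ?case
    unfolding step prod.lessThan_Suc factor power_Suc c_def[symmetric] by (simp only: mult_ac)
qed simp

text \<open>Both sides are (n + m - 1)! / (m - 1)!.\<close>

lemma binomial_pochhammer_fact:
  assumes "m > 0"
  shows "of_nat ((n + m - 1) choose (m - 1)) * fact n = (pochhammer (of_nat m) n :: 'a::field_char_0)"
proof -
  obtain r where r: "m = Suc r"
    using assms gr0_conv_Suc by blast
  have "fact (r + n) = (fact r * pochhammer (of_nat m) n :: 'a)"
    using pochhammer_product'[of "1 :: 'a" r n] by (simp add: pochhammer_fact r)
  moreover have "of_nat ((n + r) choose r) * fact n * fact r = (fact (r + n) :: 'a)"
    by (simp add: binomial_fact add_ac)
  ultimately show ?thesis
    by (simp add: r mult_ac)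
qed

lemma u_closed_form:
  fixes t :: "'a::field_char_0"
  assumes "m > 0"
  shows "u m n t = (\<Sum>k\<le>n. of_nat ((n + m - 1) choose (m - 1)) * of_nat (n choose k) *
         ((\<Prod>j<k. 2 * of_nat n + of_nat m - 1 - 2 * of_nat j) /
          (\<Prod>j<k. 2 * of_nat k + of_nat m - 1 - 2 * of_nat j)) * t ^ k)"
proof -
  define c :: 'a where "c = (of_nat m + 1) / 2"
  have c: "pochhammer c k \<noteq> 0" for k
    unfolding pochhammer_eq_0_iff c_def
    using half_Suc_add_of_nat_neq_0[of m, where ?'a = 'a] by (metis eq_neg_iff_add_eq_0)
  have "pochhammer (of_nat m) n * pochhammer c n * (bessel_coeff c k * bessel_coeff c (n - k) * t ^ k)
    = of_nat ((n + m - 1) choose (m - 1)) * of_nat (n choose k) *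
         ((\<Prod>j<k. 2 * of_nat n + of_nat m - 1 - 2 * of_nat j) /
          (\<Prod>j<k. 2 * of_nat k + of_nat m - 1 - 2 * of_nat j)) * t ^ k" if "k \<le> n" for k
  proof -
    have N: "(\<Prod>j<k. 2 * of_nat n + of_nat m - 1 - 2 * of_nat j)
        = 2 ^ k * pochhammer c n / pochhammer c (n - k)"
      using prod_step_two_pochhammer[OF that, of m, where ?'a = 'a] c[of "n - k"]
      by (simp add: c_def field_simps)
    have D: "(\<Prod>j<k. 2 * of_nat k + of_nat m - 1 - 2 * of_nat j) = 2 ^ k * pochhammer c k"
      using prod_step_two_pochhammer[of k k m, where ?'a = 'a] by (simp add: c_def)
    \<comment> \<open>The powers of 2 cancel, and the n! split off from
      \<open>pochhammer (of_nat m) n\<close> completes 1 / (k! (n - k)!) to a binomial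
      coefficient.\<close>
    show ?thesis
      unfolding N D binomial_pochhammer_fact[OF assms, symmetric] bessel_coeff_def
        binomial_fact[OF that]
      using c[of k] c[of "n - k"] by (simp add: field_simps)
  qed
  then show ?thesis
    unfolding u_eq_bessel_conv c_def[symmetric] bessel_conv_def sum_distrib_left
    by (intro sum.cong) auto
qed

section \<open>The case m = 1 and sums over compositions\<close>

lemma M_eq_u: "M n t = u 1 n t"
proof -
  \<comment> \<open>For m = 1 one has c = 1 and rising factorials of 1 are factorials, so the
    quotient supplies the second binomial factor. The generating function of \<open>M\<close> thus
    follows from the closed form.\<close>
  have "(\<Prod>j<k. 2 * of_nat n - 2 * of_nat j) / (\<Prod>j<k. 2 * of_nat k - 2 * of_nat j)
    = (of_nat (n choose k) :: 'a)" if "k \<le> n" for k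
  proof -
    have "(\<Prod>j<k. 2 * of_nat n - 2 * of_nat j) * fact (n - k) = (2 ^ k * fact n :: 'a)"
      using prod_step_two_pochhammer[OF that, of 1, where ?'a = 'a] by (simp add: pochhammer_fact)
    moreover have "(\<Prod>j<k. 2 * of_nat k - 2 * of_nat j) = (2 ^ k * fact k :: 'a)"
      using prod_step_two_pochhammer[of k k 1, where ?'a = 'a] by (simp add: pochhammer_fact)
    ultimately show ?thesis
      by (simp add: binomial_fact[OF that] field_simps)
  qed
  then show ?thesis
    by (simp add: M_def u_closed_form power2_eq_square)
qed

lemma Abs_fps_M: "Abs_fps (\<lambda>n. M n t) = inv_sqrt_series t"
  by (rule fps_ext) (simp add: M_eq_u u_def)

lemma u_eq_sum_compositions:
  assumes "m > 0"
  shows "u m n t = (\<Sum>xs \<in> {xs :: nat list. length xs = m \<and> sum_list xs = n}. \<Prod>i\<leftarrow>xs. M i t)"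
proof -
  obtain r where r: "m = Suc r"
    using assms gr0_conv_Suc by blast
  \<comment> \<open>The set \<open>natpermute n m\<close> consists of the lists of length m with sum
    n, which index the Cauchy product of m factors.\<close>
  have "u m n t = (\<Sum>xs\<in>natpermute n m. \<Prod>j=0..r. M (xs ! j) t)"
    unfolding u_def Abs_fps_M[symmetric] r fps_power_nth_Suc by simp
  also have "\<dots> = (\<Sum>xs \<in> {xs. length xs = m \<and> sum_list xs = n}. \<Prod>i\<leftarrow>xs. M i t)"
    by (rule sum.cong)
      (auto simp: natpermute_def prod.list_conv_set_nth r atLeastLessThanSuc_atLeastAtMost)
  finally show ?thesis .
qed

theorem theorem5:
  fixes m :: nat
  assumes "m > 0"
  shows "Abs_fps (\<lambda>n. M n indet) = inv_sqrt_series indet \<and>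
    (\<forall>n. u m n indet =
       (\<Sum>xs \<in> {xs :: nat list. length xs = m \<and> sum_list xs = n}. \<Prod>i\<leftarrow>xs. M i indet)) \<and>
    (\<forall>n. u m n indet =
       Sum_any (\<lambda>k. of_nat ((n + m - 1) choose (m - 1)) * of_nat (n choose k) *
         ((\<Prod>j<k. 2 * of_nat n + of_nat m - 1 - 2 * of_nat j) /
          (\<Prod>j<k. 2 * of_nat k + of_nat m - 1 - 2 * of_nat j)) * indet ^ k))"
proof (intro conjI allI)
  show "Abs_fps (\<lambda>n. M n indet) = inv_sqrt_series indet"
    by (rule Abs_fps_M)
  show "u m n indet =
      (\<Sum>xs \<in> {xs :: nat list. length xs = m \<and> sum_list xs = n}. \<Prod>i\<leftarrow>xs. M i indet)" for n
    by (rule u_eq_sum_compositions[OF assms])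
  show "u m n indet =
       Sum_any (\<lambda>k. of_nat ((n + m - 1) choose (m - 1)) * of_nat (n choose k) *
         ((\<Prod>j<k. 2 * of_nat n + of_nat m - 1 - 2 * of_nat j) /
          (\<Prod>j<k. 2 * of_nat k + of_nat m - 1 - 2 * of_nat j)) * indet ^ k)" for n
    unfolding u_closed_form[OF assms]
  \<comment> \<open>It suffices that the support lies in \<open>{..n}\<close>: for k > n the factor
    \<open>n choose k\<close> vanishes.\<close>
  proof (rule Sum_any.expand_superset[symmetric], simp, rule subsetI)
    fix k
    assume "k \<in> {k. of_nat ((n + m - 1) choose (m - 1)) * of_nat (n choose k) *
         ((\<Prod>j<k. 2 * of_nat n + of_nat m - 1 - 2 * of_nat j) /
          (\<Prod>j<k. 2 * of_nat k + of_nat m - 1 - 2 * of_nat j)) * indet ^ k \<noteq> 0}"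
    then have "n choose k \<noteq> 0"
      by (intro notI) (simp only: mem_Collect_eq of_nat_0 mult_zero_left mult_zero_right simp_thms)
    then show "k \<in> {..n}"
      by (simp add: binomial_eq_0_iff)
  qed
qed

end
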